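(* Let $\Omega$ be a nonempty finite set. The function $\phi$ (defined in the context) from the set of all sets of subsets of $\Omega$ to the set $\mathcal{O}$ of all extended graphs on $\Omega$ is well-defined, injective, and $\operatorname{Sym}(\Omega)$-invariant. Consequently, for all sets $A,B$ of subsets of $\Omega$, the pair of constant functions on $\operatorname{Stacks}(\mathcal{O})$ with images the one-entry stacks $[\phi(A)]$ and $[\phi(B)]$ is a perfect refiner for $\operatorname{Transp}(A,B)$ in extended graph backtracking.
   Context: Actions are right actions, written by exponentiation. A digraph on a set $V$ is a pair $(V,A)$ with arc set $A \subseteq V\times V$ (loops allowed); a labelled digraph on $V$ additionally has a label assigned to each vertex and each arc. $\operatorname{Sym}(V)$ acts on labelled digraphs on $V$ by renaming vertices (carrying labels along). Any action of $\operatorname{Sym}(\Omega)$ on a set induces actions elementwise on its subsets (and so on sets of subsets) and entrywise on finite lists of its elements. A function $f:X\to Y$ between sets on which $\operatorname{Sym}(\Omega)$ acts is $\operatorname{Sym}(\Omega)$-invariant if $f(x^g)=f(x)^g$ for all $x\in X$, $g\in\operatorname{Sym}(\Omega)$. Fix an infinite well-ordered set $\Lambda\supseteq\Omega$ with $\alpha<\beta$ for all $\alpha\in\Omega$, $\beta\in\Lambda\setminus\Omega$. For $\Omega\subseteq V\subseteq\Lambda$, regard $\operatorname{Sym}(\Omega)$ and $\operatorname{Sym}(V\setminus\Omega)$ as (commuting) subgroups of $\operatorname{Sym}(V)$. An extended graph on $\Omega$ is an orbit $\overline{\Gamma}$ of $\operatorname{Sym}(V\setminus\Omega)$ on the set of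 labelled digraphs on $V$, for some finite $V$ with $\Omega\subseteq V\subseteq\Lambda$. $\operatorname{Sym}(\Omega)$ acts by $(\overline{\Gamma})^g=\overline{\Gamma^g}$. Let $A=\{A_1,\dots,A_k\}$, $k\geq0$, be a set of subsets of $\Omega$, indexed arbitrarily, and let $V_k=\{\beta_1,\dots,\beta_k\}$ consist of the $k$ least elements of $\Lambda\setminus\Omega$. Let $\Gamma_A$ be the labelled digraph on $\Omega\cup V_k$ with arcs $\bigcup_{i=1}^k\{(\alpha,\beta_i):\alpha\in A_i\}$, where vertices in $\Omega$ have label white, and all other vertices and all arcs have label black (two distinct fixed labels). Then $\phi(A)=\overline{\Gamma_A}$. For a set $\mathcal{O}$ on which $\operatorname{Sym}(\Omega)$ acts, $\operatorname{Stacks}(\mathcal{O})$ is the set of all finite lists (including the empty one) with entries in $\mathcal{O}$; $|S|$ is length and $\Vert$ is concatenation. $\operatorname{Transp}(x,y) = \{g\in\operatorname{Sym}(\Omega) : x^g=y\}$. A refiner for $U\subseteq\operatorname{Sym}(\Omega)$ (with respect to $\mathcal{O}$) is a pair $(f_L,f_R)$ of functions from $\operatorname{Stacks}(\mathcal{O})$ to itself such that $U\cap\operatorname{Transp}(S,T)\subseteq\operatorname{Transp}(f_L(S),f_R(T))$ for all $S,T$. It is perfect if $U\cap\operatorname{Transp}(S,T)=\operatorname{Transp}(S\Vert f_L(S),\,T\Vert f_R(T))$ for all $S,T$ with $|S|=|T|$. Extended graph backtracking is the case where $\mathcal{O}$ is the set of all extended graphs on $\Omega$. *)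

theory Defs
  imports "HOL-Combinatorics.Permutations" "HOL-Library.Infinite_Set" "HOL-Library.FuncSet"
begin

text \<open>
  Elements of \<open>Sym(\<Omega>)\<close> are functions \<open>g\<close> with \<open>g permutes \<Omega>\<close>; they fix everything outside
  \<open>\<Omega>\<close>, so for \<open>\<Omega> \<subseteq> V\<close> both \<open>Sym(\<Omega>)\<close> and \<open>Sym(V - \<Omega>)\<close> are literally contained in \<open>Sym(V)\<close>.
  The image of a point under the right action is \<open>g x\<close>, hence the product \<open>g h\<close> of right
  actions is \<open>h \<circ> g\<close>. An action is passed around as a function \<open>act\<close>, where \<open>act x g\<close> is
  the image of \<open>x\<close> under \<open>g\<close>.
\<close>

definition Sym :: "'a set \<Rightarrow> ('a \<Rightarrow> 'a) set" where
  "Sym \<Omega> = {g. g permutes \<Omega>}"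

definition point_act :: "'a \<Rightarrow> ('a \<Rightarrow> 'a) \<Rightarrow> 'a" where
  "point_act x g = g x"

definition set_act :: "('x \<Rightarrow> ('a \<Rightarrow> 'a) \<Rightarrow> 'x) \<Rightarrow> 'x set \<Rightarrow> ('a \<Rightarrow> 'a) \<Rightarrow> 'x set" where
  "set_act act X g = (\<lambda>x. act x g) ` X"

definition list_act :: "('x \<Rightarrow> ('a \<Rightarrow> 'a) \<Rightarrow> 'x) \<Rightarrow> 'x list \<Rightarrow> ('a \<Rightarrow> 'a) \<Rightarrow> 'x list" where
  "list_act act xs g = map (\<lambda>x. act x g) xs"

definition Sym_invariant ::
  "'a set \<Rightarrow> ('x \<Rightarrow> ('a \<Rightarrow> 'a) \<Rightarrow> 'x) \<Rightarrow> ('y \<Rightarrow> ('a \<Rightarrow> 'a) \<Rightarrow> 'y) \<Rightarrow> 'x set \<Rightarrow> ('x \<Rightarrow> 'y) \<Rightarrow> bool" where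
  "Sym_invariant \<Omega> actX actY X f \<longleftrightarrow> (\<forall>x\<in>X. \<forall>g\<in>Sym \<Omega>. f (actX x g) = actY (f x) g)"

definition Transp ::
  "'a set \<Rightarrow> ('x \<Rightarrow> ('a \<Rightarrow> 'a) \<Rightarrow> 'x) \<Rightarrow> 'x \<Rightarrow> 'x \<Rightarrow> ('a \<Rightarrow> 'a) set" where
  "Transp \<Omega> act x y = {g \<in> Sym \<Omega>. act x g = y}"


text \<open>Labels are partial maps defined exactly on the vertices and on the arcs, so that equality
  of records is equality of labelled digraphs.\<close>

record ('a, 'l) ldigraph =
  verts :: "'a set"
  arcs :: "('a \<times> 'a) set"
  vlabel :: "'a \<rightharpoonup> 'l"
  alabel :: "'a \<times> 'a \<rightharpoonup> 'l"

definition ldigraphs_on :: "'a set \<Rightarrow> ('a, 'l) ldigraph set" where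
  "ldigraphs_on V =
    {\<Gamma>. verts \<Gamma> = V \<and> arcs \<Gamma> \<subseteq> V \<times> V \<and> dom (vlabel \<Gamma>) = V \<and> dom (alabel \<Gamma>) = arcs \<Gamma>}"

definition ldigraph_act :: "('a, 'l) ldigraph \<Rightarrow> ('a \<Rightarrow> 'a) \<Rightarrow> ('a, 'l) ldigraph" where
  "ldigraph_act \<Gamma> g =
    \<lparr>verts = g ` verts \<Gamma>,
     arcs = map_prod g g ` arcs \<Gamma>,
     vlabel = (\<lambda>x. vlabel \<Gamma> (inv g x)),
     alabel = (\<lambda>(x, y). alabel \<Gamma> (inv g x, inv g y))\<rparr>"


definition ext_orbit :: "'a set \<Rightarrow> ('a, 'l) ldigraph \<Rightarrow> ('a, 'l) ldigraph set" where
  "ext_orbit \<Omega> \<Gamma> = {ldigraph_act \<Gamma> h | h. h \<in> Sym (verts \<Gamma> - \<Omega>)}"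

definition extended_graphs :: "'a set \<Rightarrow> 'a set \<Rightarrow> ('a, 'l) ldigraph set set" where
  "extended_graphs \<Lambda> \<Omega> =
    {ext_orbit \<Omega> \<Gamma> | \<Gamma> V. finite V \<and> \<Omega> \<subseteq> V \<and> V \<subseteq> \<Lambda> \<and> \<Gamma> \<in> ldigraphs_on V}"

text \<open>Well-definedness of the following is lemma \<open>ext_act_ext_orbit\<close> below.\<close>

definition ext_act ::
  "'a set \<Rightarrow> ('a, 'l) ldigraph set \<Rightarrow> ('a \<Rightarrow> 'a) \<Rightarrow> ('a, 'l) ldigraph set" where
  "ext_act \<Omega> X g =
    (THE Y. \<exists>\<Gamma>. X = ext_orbit \<Omega> \<Gamma> \<and> Y = ext_orbit \<Omega> (ldigraph_act \<Gamma> g))"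


text \<open>With \<open>0\<close>-based indices, \<open>beta \<Lambda> \<Omega> i\<close> is the \<open>i\<close>-th smallest element of \<open>\<Lambda> - \<Omega>\<close>.\<close>

definition beta :: "'a::wellorder set \<Rightarrow> 'a set \<Rightarrow> nat \<Rightarrow> 'a" where
  "beta \<Lambda> \<Omega> i = enumerate (\<Lambda> - \<Omega>) i"

definition Gamma ::
  "'a::wellorder set \<Rightarrow> 'a set \<Rightarrow> 'l \<Rightarrow> 'l \<Rightarrow> 'a set list \<Rightarrow> ('a, 'l) ldigraph" where
  "Gamma \<Lambda> \<Omega> white black As =
    (let Vk = beta \<Lambda> \<Omega> ` {..<length As};
         E = (\<Union>i<length As. {(\<alpha>, beta \<Lambda> \<Omega> i) | \<alpha>. \<alpha> \<in> As ! i})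
     in \<lparr>verts = \<Omega> \<union> Vk,
         arcs = E,
         vlabel = (\<lambda>x. if x \<in> \<Omega> then Some white else if x \<in> Vk then Some black else None),
         alabel = (\<lambda>e. if e \<in> E then Some black else None)\<rparr>)"

text \<open>The values that \<open>\<phi>(A)\<close> may take under the possible indexings of \<open>A\<close>, which are the
  repetition-free lists \<open>As\<close> with \<open>set As = A\<close>.\<close>

definition is_phi_value ::
  "'a::wellorder set \<Rightarrow> 'a set \<Rightarrow> 'l \<Rightarrow> 'l \<Rightarrow> 'a set set \<Rightarrow> ('a, 'l) ldigraph set \<Rightarrow> bool" where
  "is_phi_value \<Lambda> \<Omega> white black A X \<longleftrightarrow>
    (\<exists>As. distinct As \<and> set As = A \<and> X = ext_orbit \<Omega> (Gamma \<Lambda> \<Omega> white black As))"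

definition phi ::
  "'a::wellorder set \<Rightarrow> 'a set \<Rightarrow> 'l \<Rightarrow> 'l \<Rightarrow> 'a set set \<Rightarrow> ('a, 'l) ldigraph set" where
  "phi \<Lambda> \<Omega> white black A = (THE X. is_phi_value \<Lambda> \<Omega> white black A X)"


abbreviation Stacks :: "'x set \<Rightarrow> 'x list set" where
  "Stacks \<O> \<equiv> lists \<O>"

definition refiner ::
  "'a set \<Rightarrow> ('x \<Rightarrow> ('a \<Rightarrow> 'a) \<Rightarrow> 'x) \<Rightarrow> 'x set \<Rightarrow> ('a \<Rightarrow> 'a) set
    \<Rightarrow> ('x list \<Rightarrow> 'x list) \<times> ('x list \<Rightarrow> 'x list) \<Rightarrow> bool" where
  "refiner \<Omega> act \<O> U = (\<lambda>(fL, fR).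
    U \<subseteq> Sym \<Omega> \<and> fL \<in> Stacks \<O> \<rightarrow> Stacks \<O> \<and> fR \<in> Stacks \<O> \<rightarrow> Stacks \<O> \<and>
    (\<forall>S\<in>Stacks \<O>. \<forall>T\<in>Stacks \<O>.
      U \<inter> Transp \<Omega> (list_act act) S T \<subseteq> Transp \<Omega> (list_act act) (fL S) (fR T)))"

definition perfect_refiner ::
  "'a set \<Rightarrow> ('x \<Rightarrow> ('a \<Rightarrow> 'a) \<Rightarrow> 'x) \<Rightarrow> 'x set \<Rightarrow> ('a \<Rightarrow> 'a) set
    \<Rightarrow> ('x list \<Rightarrow> 'x list) \<times> ('x list \<Rightarrow> 'x list) \<Rightarrow> bool" where
  "perfect_refiner \<Omega> act \<O> U = (\<lambda>(fL, fR).
    refiner \<Omega> act \<O> U (fL, fR) \<and>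
    (\<forall>S\<in>Stacks \<O>. \<forall>T\<in>Stacks \<O>. length S = length T \<longrightarrow>
      U \<inter> Transp \<Omega> (list_act act) S T = Transp \<Omega> (list_act act) (S @ fL S) (T @ fR T)))"


lemma ldigraph_act_comp:
  assumes "bij g" "bij h"
  shows "ldigraph_act (ldigraph_act \<Gamma> g) h = ldigraph_act \<Gamma> (h \<circ> g)"
  using assms
  by (simp add: ldigraph_act_def o_inv_distrib image_comp map_prod.comp case_prod_beta fun_eq_iff)

lemma Sym_commute:
  assumes "g \<in> Sym \<Omega>" "h \<in> Sym (V - \<Omega>)"
  shows "g \<circ> h = h \<circ> g"
proof
  fix x
  have g: "g permutes \<Omega>" and h: "h permutes (V - \<Omega>)" using assms by (auto simp: Sym_def)
  show "(g \<circ> h) x = (h \<circ> g) x"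
  proof (cases "x \<in> \<Omega>")
    case True
    then have "g x \<in> \<Omega>" using g by (simp add: permutes_in_image)
    then show ?thesis using True h by (simp add: permutes_not_in)
  next
    case False
    then have "h x \<notin> \<Omega>"
      using h by (metis Diff_iff permutes_in_image permutes_not_in)
    then show ?thesis using False g by (simp add: permutes_not_in)
  qed
qed

lemma image_Diff_Sym:
  assumes "g \<in> Sym \<Omega>"
  shows "g ` V - \<Omega> = V - \<Omega>"
proof -
  have g: "g permutes \<Omega>" using assms by (simp add: Sym_def)
  have "g x \<in> \<Omega> \<longleftrightarrow> x \<in> \<Omega>" for x using g by (rule permutes_in_image)
  moreover have "g x = x" if "x \<notin> \<Omega>" for x using g that by (rule permutes_not_in)
  ultimately show ?thesis by force
qed

lemma ext_act_ext_orbit: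
  assumes "g \<in> Sym \<Omega>"
  shows "ext_act \<Omega> (ext_orbit \<Omega> \<Gamma>) g = ext_orbit \<Omega> (ldigraph_act \<Gamma> g)"
proof -
  have eq: "ext_orbit \<Omega> (ldigraph_act \<Delta> g) = (\<lambda>\<Gamma>'. ldigraph_act \<Gamma>' g) ` ext_orbit \<Omega> \<Delta>"
    for \<Delta> :: "('a, 'b) ldigraph"
  proof -
    have "verts (ldigraph_act \<Delta> g) - \<Omega> = verts \<Delta> - \<Omega>"
      using image_Diff_Sym[OF assms] by (simp add: ldigraph_act_def)
    moreover have "ldigraph_act (ldigraph_act \<Delta> g) h = ldigraph_act (ldigraph_act \<Delta> h) g"
      if "h \<in> Sym (verts \<Delta> - \<Omega>)" for h
    proof -
      have "bij g" "bij h" using assms that by (auto simp: Sym_def permutes_bij)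
      then show ?thesis using Sym_commute[OF assms that] by (simp add: ldigraph_act_comp)
    qed
    ultimately show ?thesis
      by (simp add: ext_orbit_def Setcompr_eq_image image_image cong: image_cong)
  qed
  show ?thesis unfolding ext_act_def
    by (rule the_equality) (auto simp: eq)
qed

end

(* A member of the orbit phi(A) determines A: the sets of in-neighbours in \<Omega> of the vertices outside
  \<Omega> are the members of A, and the permutations of V - \<Omega> only relocate them. This gives injectivity.
  Reindexing A permutes the \<beta>_i, which stays within the orbit, and a permutation g of \<Omega>
  maps \<Gamma>_A to \<Gamma>_{A^g}; this gives well-definedness and invariance. The refiner is then perfect
  because phi(A)^g = phi(A^g) equals phi(B) exactly when A^g = B. *)
theory Submission
  imports Defs
begin

section \<open>Orbits under permutations of the vertices outside \<Omega>\<close>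

lemma verts_ldigraph_act_Sym:
  assumes "h \<in> Sym (verts \<Gamma> - \<Omega>)"
  shows "verts (ldigraph_act \<Gamma> h) = verts \<Gamma>"
  using assms
  by (auto simp: ldigraph_act_def Sym_def intro!: permutes_image elim: permutes_subset)

text \<open>Since \<open>h\<close> keeps the vertex set, both orbits are taken under the same group,
  and two successive renamings by its elements compose to a single one.\<close>

lemma ext_orbit_ldigraph_act_subset:
  assumes h: "h \<in> Sym (verts \<Gamma> - \<Omega>)"
  shows "ext_orbit \<Omega> (ldigraph_act \<Gamma> h) \<subseteq> ext_orbit \<Omega> \<Gamma>"
proof
  fix \<Delta> assume "\<Delta> \<in> ext_orbit \<Omega> (ldigraph_act \<Gamma> h)"
  then obtain k where k: "k \<in> Sym (verts \<Gamma> - \<Omega>)" and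
    \<Delta>: "\<Delta> = ldigraph_act (ldigraph_act \<Gamma> h) k"
    by (auto simp: ext_orbit_def verts_ldigraph_act_Sym[OF h])
  have "\<Delta> = ldigraph_act \<Gamma> (k \<circ> h)"
    using h k unfolding \<Delta> by (auto simp: Sym_def permutes_bij ldigraph_act_comp)
  moreover have "k \<circ> h \<in> Sym (verts \<Gamma> - \<Omega>)"
    using h k by (simp add: Sym_def permutes_compose)
  ultimately show "\<Delta> \<in> ext_orbit \<Omega> \<Gamma>" by (auto simp: ext_orbit_def)
qed

lemma ldigraph_act_id [simp]: "ldigraph_act \<Gamma> id = \<Gamma>"
  by (simp add: ldigraph_act_def map_prod.id)

text \<open>The missing inclusion is the previous lemma for \<open>inv h\<close>, which carries the
  renamed digraph back to \<Gamma>. Any member of an orbit may thus serve as its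
  representative.\<close>

lemma ext_orbit_ldigraph_act:
  assumes h: "h \<in> Sym (verts \<Gamma> - \<Omega>)"
  shows "ext_orbit \<Omega> (ldigraph_act \<Gamma> h) = ext_orbit \<Omega> \<Gamma>"
proof
  have p: "h permutes (verts \<Gamma> - \<Omega>)" using h by (simp add: Sym_def)
  have "ldigraph_act (ldigraph_act \<Gamma> h) (inv h) = \<Gamma>"
    using p by (simp add: ldigraph_act_comp permutes_bij bij_imp_bij_inv permutes_inv_o)
  moreover have "inv h \<in> Sym (verts (ldigraph_act \<Gamma> h) - \<Omega>)"
    using p by (simp add: verts_ldigraph_act_Sym[OF h] Sym_def permutes_inv)
  ultimately show "ext_orbit \<Omega> \<Gamma> \<subseteq> ext_orbit \<Omega> (ldigraph_act \<Gamma> h)"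
    using ext_orbit_ldigraph_act_subset by fastforce
qed (rule ext_orbit_ldigraph_act_subset[OF h])

lemma ext_orbit_self: "\<Gamma> \<in> ext_orbit \<Omega> \<Gamma>"
proof -
  have "id \<in> Sym (verts \<Gamma> - \<Omega>)" by (simp add: Sym_def permutes_id)
  then show ?thesis
    unfolding ext_orbit_def using ldigraph_act_id by (metis (mono_tags, lifting) mem_Collect_eq)
qed


section \<open>An orbit invariant that recovers A from its digraph\<close>

text \<open>The family is collected as a set, which forgets which outside vertex each member belongs
  to; this is exactly the information that a permutation of those vertices destroys.\<close>

definition in_nbhds :: "'a set \<Rightarrow> ('a, 'l) ldigraph \<Rightarrow> 'a set set" where
  "in_nbhds \<Omega> \<Gamma> = (\<lambda>v. {\<alpha> \<in> \<Omega>. (\<alpha>, v) \<in> arcs \<Gamma>}) ` (verts \<Gamma> - \<Omega>)"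

text \<open>Because \<open>h\<close> fixes \<Omega> pointwise, the in-neighbourhood of
  \<open>v\<close> becomes, unchanged, that of \<open>h v\<close>. As \<open>h\<close> permutes the
  outside vertices, the whole family is the same.\<close>

lemma in_nbhds_ldigraph_act:
  assumes h: "h \<in> Sym (verts \<Gamma> - \<Omega>)"
  shows "in_nbhds \<Omega> (ldigraph_act \<Gamma> h) = in_nbhds \<Omega> \<Gamma>"
proof -
  have p: "h permutes (verts \<Gamma> - \<Omega>)" using h by (simp add: Sym_def)
  have arcs: "(\<alpha>, h v) \<in> arcs (ldigraph_act \<Gamma> h) \<longleftrightarrow> (\<alpha>, v) \<in> arcs \<Gamma>" if "\<alpha> \<in> \<Omega>" for \<alpha> v
  proof -
    have "h \<alpha> = \<alpha>" using p that by (auto simp: permutes_not_in)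
    then have "(\<alpha>, h v) = map_prod h h (\<alpha>, v)" by simp
    then show ?thesis
      unfolding ldigraph_act_def
      using inj_image_mem_iff[OF prod.inj_map[OF permutes_inj[OF p] permutes_inj[OF p]]]
      by (metis ldigraph.select_convs(2))
  qed
  \<comment> \<open>The index set is replaced by its own image under \<open>h\<close>, so that every
    index has the form \<open>h v\<close> and \<open>arcs\<close> applies.\<close>
  have "in_nbhds \<Omega> (ldigraph_act \<Gamma> h) =
      (\<lambda>v. {\<alpha> \<in> \<Omega>. (\<alpha>, v) \<in> arcs (ldigraph_act \<Gamma> h)}) ` h ` (verts \<Gamma> - \<Omega>)"
    by (simp add: in_nbhds_def verts_ldigraph_act_Sym[OF h] permutes_image[OF p])
  then show ?thesis by (simp add: in_nbhds_def image_image arcs cong: conj_cong)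
qed

lemma in_nbhds_eq_if_ext_orbit_eq:
  assumes "ext_orbit \<Omega> \<Gamma> = ext_orbit \<Omega> \<Delta>"
  shows "in_nbhds \<Omega> \<Gamma> = in_nbhds \<Omega> \<Delta>"
proof -
  have "\<Gamma> \<in> ext_orbit \<Omega> \<Delta>" using assms ext_orbit_self by metis
  then show ?thesis by (auto simp: ext_orbit_def in_nbhds_ldigraph_act)
qed


section \<open>The digraph of an indexed family of subsets\<close>

lemma beta_in: "infinite (\<Lambda> - \<Omega>) \<Longrightarrow> beta \<Lambda> \<Omega> i \<in> \<Lambda> - \<Omega>"
  unfolding beta_def by (rule enumerate_in_set)

lemma inj_beta: "infinite (\<Lambda> - \<Omega>) \<Longrightarrow> inj (beta \<Lambda> \<Omega>)"
  unfolding beta_def by (metis inj_enumerate)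

lemma verts_Gamma: "verts (Gamma \<Lambda> \<Omega> w b As) = \<Omega> \<union> beta \<Lambda> \<Omega> ` {..<length As}"
  by (simp add: Gamma_def Let_def)

lemma arcs_Gamma:
  "arcs (Gamma \<Lambda> \<Omega> w b As) = (\<Union>i<length As. {(\<alpha>, beta \<Lambda> \<Omega> i) | \<alpha>. \<alpha> \<in> As ! i})"
  by (simp add: Gamma_def Let_def)

lemma vlabel_Gamma:
  "vlabel (Gamma \<Lambda> \<Omega> w b As) =
    (\<lambda>x. if x \<in> \<Omega> then Some w else if x \<in> beta \<Lambda> \<Omega> ` {..<length As} then Some b else None)"
  by (simp add: Gamma_def Let_def)

lemma alabel_Gamma:
  "alabel (Gamma \<Lambda> \<Omega> w b As) = (\<lambda>e. if e \<in> arcs (Gamma \<Lambda> \<Omega> w b As) then Some b else None)"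
  by (simp add: Gamma_def Let_def)

lemma verts_Gamma_Diff:
  assumes "infinite (\<Lambda> - \<Omega>)"
  shows "verts (Gamma \<Lambda> \<Omega> w b As) - \<Omega> = beta \<Lambda> \<Omega> ` {..<length As}"
  using beta_in[OF assms] by (auto simp: verts_Gamma)

text \<open>Injectivity of \<open>beta\<close> ensures that the vertex with index \<open>i\<close>
  receives arcs from \<open>As ! i\<close> only; as \<open>As ! i\<close> lies in \<Omega>,
  restricting to in-neighbours in \<Omega> loses nothing.\<close>

lemma in_nbhds_Gamma:
  assumes inf: "infinite (\<Lambda> - \<Omega>)" and As: "set As \<subseteq> Pow \<Omega>"
  shows "in_nbhds \<Omega> (Gamma \<Lambda> \<Omega> w b As) = set As"
proof -
  have "{\<alpha> \<in> \<Omega>. (\<alpha>, beta \<Lambda> \<Omega> i) \<in> arcs (Gamma \<Lambda> \<Omega> w b As)} = As ! i"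
    if i: "i < length As" for i
  proof -
    have "As ! i \<subseteq> \<Omega>" using As nth_mem[OF i] by blast
    then show ?thesis using i by (auto simp: arcs_Gamma inj_eq[OF inj_beta[OF inf]])
  qed
  then show ?thesis
    unfolding in_nbhds_def verts_Gamma_Diff[OF inf] image_image
    by (auto simp: set_conv_nth)
qed

lemma Gamma_in_ldigraphs_on:
  assumes "set As \<subseteq> Pow \<Omega>"
  shows "Gamma \<Lambda> \<Omega> w b As \<in> ldigraphs_on (\<Omega> \<union> beta \<Lambda> \<Omega> ` {..<length As})"
proof -
  have "As ! i \<subseteq> \<Omega>" if "i < length As" for i
    using assms nth_mem[OF that] by blast
  then have "arcs (Gamma \<Lambda> \<Omega> w b As) \<subseteq>
      (\<Omega> \<union> beta \<Lambda> \<Omega> ` {..<length As}) \<times> (\<Omega> \<union> beta \<Lambda> \<Omega> ` {..<length As})"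
    unfolding arcs_Gamma by blast
  then show ?thesis
    by (auto simp: ldigraphs_on_def verts_Gamma vlabel_Gamma alabel_Gamma dom_def)
qed

lemma ext_orbit_Gamma_in_extended_graphs:
  assumes inf: "infinite (\<Lambda> - \<Omega>)" and "finite \<Omega>" "\<Omega> \<subseteq> \<Lambda>" "set As \<subseteq> Pow \<Omega>"
  shows "ext_orbit \<Omega> (Gamma \<Lambda> \<Omega> w b As) \<in> extended_graphs \<Lambda> \<Omega>"
proof -
  let ?V = "\<Omega> \<union> beta \<Lambda> \<Omega> ` {..<length As}"
  have "finite ?V" "\<Omega> \<subseteq> ?V" "?V \<subseteq> \<Lambda>" using assms beta_in[OF inf] by auto
  then show ?thesis
    unfolding extended_graphs_def
    by (intro CollectI exI[of _ "Gamma \<Lambda> \<Omega> w b As"] exI[of _ ?V] conjI refl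
        Gamma_in_ldigraphs_on assms(4))
qed

section \<open>Renaming the vertices of \<open>Gamma\<close>\<close>

text \<open>One computation serves two purposes: with \<open>p\<close> the identity and
  \<open>g\<close> in \<open>Sym \<Omega>\<close> it gives invariance, and with \<open>g\<close>
  fixing \<Omega> pointwise it gives independence of the indexing.\<close>

lemma ldigraph_act_Gamma:
  assumes g: "bij g" "g ` \<Omega> = \<Omega>"
    and p: "p permutes {..<length As}" "\<And>i. i < length As \<Longrightarrow> g (beta \<Lambda> \<Omega> i) = beta \<Lambda> \<Omega> (p i)"
    and Bs: "length Bs = length As" "\<And>i. i < length As \<Longrightarrow> Bs ! p i = g ` (As ! i)"
  shows "ldigraph_act (Gamma \<Lambda> \<Omega> w b As) g = Gamma \<Lambda> \<Omega> w b Bs"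
proof -
  let ?I = "{..<length As}" and ?V = "beta \<Lambda> \<Omega> ` {..<length As}"
  let ?E = "\<lambda>Xs. arcs (Gamma \<Lambda> \<Omega> w b Xs)"
  have V: "g ` ?V = ?V"
  proof -
    have "g ` ?V = beta \<Lambda> \<Omega> ` p ` ?I" using p(2) by (simp add: image_image)
    then show ?thesis by (simp add: permutes_image[OF p(1)])
  qed
  have E: "map_prod g g ` ?E As = ?E Bs"
  proof -
    have "map_prod g g ` ?E As = (\<Union>i\<in>?I. (\<lambda>\<alpha>. (g \<alpha>, g (beta \<Lambda> \<Omega> i))) ` (As ! i))"
      unfolding arcs_Gamma by (fastforce simp: image_UN)
    \<comment> \<open>The tails \<open>g \<alpha>\<close> with \<alpha> in \<open>As ! i\<close> run
      through \<open>Bs ! p i\<close>; then \<open>j = p i\<close> becomes the new index, which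
      again runs through all of \<open>?I\<close>.\<close>
    also have "\<dots> = (\<Union>i\<in>?I. (\<lambda>\<alpha>. (\<alpha>, beta \<Lambda> \<Omega> (p i))) ` (Bs ! p i))"
      using p(2) Bs(2) by (simp add: image_image)
    also have "\<dots> = (\<Union>j\<in>p ` ?I. (\<lambda>\<alpha>. (\<alpha>, beta \<Lambda> \<Omega> j)) ` (Bs ! j))" by simp
    also have "\<dots> = ?E Bs" unfolding permutes_image[OF p(1)] arcs_Gamma using Bs(1) by auto
    finally show ?thesis .
  qed
  \<comment> \<open>The action reads labels at \<open>inv g\<close>. Since the labels of
    \<open>Gamma\<close> depend only on membership in \<Omega>, \<open>?V\<close> and the arc set,
    it suffices to pull these memberships back along \<open>g\<close>.\<close>
  have inv_iff: "inv g x \<in> X \<longleftrightarrow> x \<in> X" if "g ` X = X" for x X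
    using inj_image_mem_iff[OF bij_is_inj[OF g(1)], of "inv g x" X] that g(1)
    by (simp add: bij_is_surj surj_f_inv_f)
  have inv_E: "(inv g x, inv g y) \<in> ?E As \<longleftrightarrow> (x, y) \<in> ?E Bs" for x y
  proof -
    have "inj (map_prod g g)" using g(1) by (simp add: bij_is_inj prod.inj_map)
    then have "(inv g x, inv g y) \<in> ?E As \<longleftrightarrow> map_prod g g (inv g x, inv g y) \<in> ?E Bs"
      unfolding E[symmetric] by (rule inj_image_mem_iff[symmetric])
    then show ?thesis using g(1) by (simp add: bij_is_surj surj_f_inv_f)
  qed
  show ?thesis
  proof (rule ldigraph.equality)
    show "verts (ldigraph_act (Gamma \<Lambda> \<Omega> w b As) g) = verts (Gamma \<Lambda> \<Omega> w b Bs)"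
      using g(2) V by (simp add: ldigraph_act_def verts_Gamma Bs(1) image_Un)
    show "arcs (ldigraph_act (Gamma \<Lambda> \<Omega> w b As) g) = ?E Bs"
      using E by (simp add: ldigraph_act_def)
    show "vlabel (ldigraph_act (Gamma \<Lambda> \<Omega> w b As) g) = vlabel (Gamma \<Lambda> \<Omega> w b Bs)"
      by (simp add: ldigraph_act_def vlabel_Gamma Bs(1) inv_iff[OF g(2)] inv_iff[OF V] fun_eq_iff)
    show "alabel (ldigraph_act (Gamma \<Lambda> \<Omega> w b As) g) = alabel (Gamma \<Lambda> \<Omega> w b Bs)"
      by (simp add: ldigraph_act_def alabel_Gamma inv_E fun_eq_iff)
  qed simp
qed

text \<open>An element of \<open>Sym \<Omega>\<close> fixes every
  \<open>beta \<Lambda> \<Omega> i\<close>, so indices stay put and only the subsets move.\<close>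

lemma ldigraph_act_Gamma_Sym:
  assumes inf: "infinite (\<Lambda> - \<Omega>)" and g: "g \<in> Sym \<Omega>"
  shows "ldigraph_act (Gamma \<Lambda> \<Omega> w b As) g = Gamma \<Lambda> \<Omega> w b (map ((`) g) As)"
proof (rule ldigraph_act_Gamma)
  have p: "g permutes \<Omega>" using g by (simp add: Sym_def)
  show "bij g" "g ` \<Omega> = \<Omega>" using p by (auto simp: permutes_bij permutes_image)
  show "g (beta \<Lambda> \<Omega> i) = beta \<Lambda> \<Omega> (id i)" for i
    using beta_in[OF inf] p by (simp add: permutes_not_in)
  show "id permutes {..<length As}" by (rule permutes_id)
qed simp_all

text \<open>A change of indexing is a permutation of indices; carried over by \<open>beta\<close> to
  the vertices outside \<Omega>, it becomes an element of the group whose orbits are taken.\<close>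

lemma ext_orbit_Gamma_reindex:
  assumes inf: "infinite (\<Lambda> - \<Omega>)"
    and As: "set As \<subseteq> Pow \<Omega>" "distinct As" "distinct Bs" "set As = set Bs"
  shows "ext_orbit \<Omega> (Gamma \<Lambda> \<Omega> w b As) = ext_orbit \<Omega> (Gamma \<Lambda> \<Omega> w b Bs)"
proof -
  \<comment> \<open>Repetition-free lists with equal sets differ by a permutation \<open>p\<close>
    of positions, here in the direction \<open>As ! i = Bs ! p i\<close>.\<close>
  have "mset As = mset Bs" using As by (simp add: set_eq_iff_mset_eq_distinct)
  then obtain p where p: "p permutes {..<length Bs}" and eq: "permute_list p Bs = As"
    by (rule mset_eq_permutation)
  have len: "length Bs = length As" using eq by auto
  let ?I = "{..<length As}"
  let ?V = "beta \<Lambda> \<Omega> ` ?I"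
  have inj: "inj_on (beta \<Lambda> \<Omega>) ?I" using inj_beta[OF inf] by (rule inj_on_subset) simp
  \<comment> \<open>This is \<open>p\<close> conjugated by \<open>beta\<close> and extended by the
    identity, so it moves no point of \<Omega>.\<close>
  define h where "h = (\<lambda>x. if x \<in> ?V then beta \<Lambda> \<Omega> (p (inv_into ?I (beta \<Lambda> \<Omega>) x)) else x)"
  have h: "h permutes ?V"
    unfolding h_def using p inj len
    by (intro permutes_bij_inv_into) (auto simp: bij_betw_def)
  have h_fix: "h \<alpha> = \<alpha>" if "\<alpha> \<in> \<Omega>" for \<alpha>
    using that beta_in[OF inf] by (auto simp: h_def)
  have "ldigraph_act (Gamma \<Lambda> \<Omega> w b As) h = Gamma \<Lambda> \<Omega> w b Bs"
  proof (rule ldigraph_act_Gamma)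
    show "bij h" using h by (rule permutes_bij)
    show "h ` \<Omega> = \<Omega>" using h_fix by simp
    show "p permutes ?I" using p len by simp
    show "h (beta \<Lambda> \<Omega> i) = beta \<Lambda> \<Omega> (p i)" if "i < length As" for i
      using that inj by (simp add: h_def inv_into_f_f)
    show "Bs ! p i = h ` (As ! i)" if i: "i < length As" for i
    proof -
      have "As ! i \<subseteq> \<Omega>" using As(1) nth_mem[OF i] by blast
      then have "h ` (As ! i) = As ! i" using h_fix by (auto simp: subset_iff image_iff)
      then show ?thesis using eq i len p by (metis permute_list_nth)
    qed
  qed (rule len)
  moreover have h_Sym: "h \<in> Sym (verts (Gamma \<Lambda> \<Omega> w b As) - \<Omega>)"
    unfolding verts_Gamma_Diff[OF inf] using h by (simp add: Sym_def)
  ultimately show ?thesis using ext_orbit_ldigraph_act[OF h_Sym] by simp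
qed


section \<open>Well-definedness, injectivity and invariance of \<open>phi\<close>\<close>

text \<open>Finiteness of \<Omega> makes A finite, so an indexing exists; any two indexings give one
  orbit by \<open>ext_orbit_Gamma_reindex\<close>.\<close>

lemma ex1_is_phi_value:
  assumes inf: "infinite (\<Lambda> - \<Omega>)" and "finite \<Omega>" and A: "A \<subseteq> Pow \<Omega>"
  shows "\<exists>!X. is_phi_value \<Lambda> \<Omega> w b A X"
proof -
  have "finite A" using finite_subset[OF A] assms(2) by simp
  then obtain As where As: "set As = A" "distinct As" using finite_distinct_list by blast
  show ?thesis
  proof (rule ex1I)
    show "is_phi_value \<Lambda> \<Omega> w b A (ext_orbit \<Omega> (Gamma \<Lambda> \<Omega> w b As))"
      unfolding is_phi_value_def using As by blast
    fix X assume "is_phi_value \<Lambda> \<Omega> w b A X"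
    then obtain Bs where "distinct Bs" "set Bs = A" "X = ext_orbit \<Omega> (Gamma \<Lambda> \<Omega> w b Bs)"
      unfolding is_phi_value_def by blast
    then show "X = ext_orbit \<Omega> (Gamma \<Lambda> \<Omega> w b As)"
      using ext_orbit_Gamma_reindex[OF inf, of Bs As w b] A As by simp
  qed
qed

lemma phi_eq:
  assumes "infinite (\<Lambda> - \<Omega>)" "finite \<Omega>" "set As \<subseteq> Pow \<Omega>" "distinct As"
  shows "phi \<Lambda> \<Omega> w b (set As) = ext_orbit \<Omega> (Gamma \<Lambda> \<Omega> w b As)"
  unfolding phi_def using assms
  by (intro the1_equality ex1_is_phi_value) (auto simp: is_phi_value_def)

lemma phi_indexing:
  assumes "infinite (\<Lambda> - \<Omega>)" "finite \<Omega>" "A \<subseteq> Pow \<Omega>"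
  obtains As where "set As = A" "distinct As" "phi \<Lambda> \<Omega> w b A = ext_orbit \<Omega> (Gamma \<Lambda> \<Omega> w b As)"
proof -
  have "finite A" using finite_subset[OF assms(3)] assms(2) by simp
  then obtain As where As: "set As = A" "distinct As" using finite_distinct_list by blast
  then have "phi \<Lambda> \<Omega> w b A = ext_orbit \<Omega> (Gamma \<Lambda> \<Omega> w b As)"
    using phi_eq[OF assms(1,2), of As w b] assms(3) by simp
  with As show thesis by (rule that)
qed

lemma inj_on_phi:
  assumes "infinite (\<Lambda> - \<Omega>)" "finite \<Omega>"
  shows "inj_on (phi \<Lambda> \<Omega> w b) (Pow (Pow \<Omega>))"
proof (rule inj_onI)
  fix A B assume AB: "A \<in> Pow (Pow \<Omega>)" "B \<in> Pow (Pow \<Omega>)" "phi \<Lambda> \<Omega> w b A = phi \<Lambda> \<Omega> w b B"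
  obtain As where As: "set As = A" "distinct As" "phi \<Lambda> \<Omega> w b A = ext_orbit \<Omega> (Gamma \<Lambda> \<Omega> w b As)"
    by (rule phi_indexing[OF assms PowD[OF AB(1)]])
  obtain Bs where Bs: "set Bs = B" "distinct Bs" "phi \<Lambda> \<Omega> w b B = ext_orbit \<Omega> (Gamma \<Lambda> \<Omega> w b Bs)"
    by (rule phi_indexing[OF assms PowD[OF AB(2)]])
  \<comment> \<open>By \<open>in_nbhds_Gamma\<close> the two sides are A and B.\<close>
  have "in_nbhds \<Omega> (Gamma \<Lambda> \<Omega> w b As) = in_nbhds \<Omega> (Gamma \<Lambda> \<Omega> w b Bs)"
    using AB(3) As(3) Bs(3) by (intro in_nbhds_eq_if_ext_orbit_eq) simp
  then show "A = B" using AB As(1) Bs(1) by (simp add: in_nbhds_Gamma[OF assms(1)])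
qed

lemma set_act_set_act_point: "set_act (set_act point_act) A g = (`) g ` A"
  by (simp add: set_act_def point_act_def)

lemma set_act_in_Pow_Pow:
  assumes "A \<in> Pow (Pow \<Omega>)" "g \<in> Sym \<Omega>"
  shows "set_act (set_act point_act) A g \<in> Pow (Pow \<Omega>)"
proof -
  have "g ` X \<subseteq> \<Omega>" if "X \<subseteq> \<Omega>" for X
    using image_mono[OF that, of g] assms(2) by (simp add: Sym_def permutes_image)
  then show ?thesis using assms(1) unfolding set_act_set_act_point by blast
qed

lemma Sym_invariant_phi:
  assumes "infinite (\<Lambda> - \<Omega>)" "finite \<Omega>"
  shows "Sym_invariant \<Omega> (set_act (set_act point_act)) (ext_act \<Omega>) (Pow (Pow \<Omega>)) (phi \<Lambda> \<Omega> w b)"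
  unfolding Sym_invariant_def
proof (intro ballI)
  fix A g assume A: "A \<in> Pow (Pow \<Omega>)" and g: "g \<in> Sym \<Omega>"
  obtain As where As: "set As = A" "distinct As" "phi \<Lambda> \<Omega> w b A = ext_orbit \<Omega> (Gamma \<Lambda> \<Omega> w b As)"
    by (rule phi_indexing[OF assms PowD[OF A]])
  let ?Bs = "map ((`) g) As"
  have B: "set ?Bs = set_act (set_act point_act) A g" by (simp add: set_act_set_act_point As(1))
  \<comment> \<open>Injectivity on points passes to images of sets, so \<open>?Bs\<close> is again
    repetition-free and hence a valid indexing of the image of A.\<close>
  have "inj g" using g by (auto simp: Sym_def permutes_inj)
  then have "distinct ?Bs"
    using As(2) by (simp add: distinct_map inj_on_def inj_image_eq_iff)
  then have "phi \<Lambda> \<Omega> w b (set ?Bs) = ext_orbit \<Omega> (Gamma \<Lambda> \<Omega> w b ?Bs)"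
    using set_act_in_Pow_Pow[OF A g] B by (intro phi_eq assms) auto
  then show "phi \<Lambda> \<Omega> w b (set_act (set_act point_act) A g) = ext_act \<Omega> (phi \<Lambda> \<Omega> w b A) g"
    by (simp only: B As(3) ext_act_ext_orbit[OF g] ldigraph_act_Gamma_Sym[OF assms(1) g])
qed

section \<open>The perfect refiner\<close>

text \<open>With one entry appended to each stack, \<open>g\<close> maps one extended stack to the
  other exactly when it maps S to T and \<open>x\<close> to \<open>y\<close>.\<close>

lemma perfect_refiner_constI:
  assumes "x \<in> \<O>" "y \<in> \<O>"
  shows "perfect_refiner \<Omega> act \<O> (Transp \<Omega> act x y) (\<lambda>_. [x], \<lambda>_. [y])"
  using assms by (auto simp: perfect_refiner_def refiner_def Transp_def list_act_def)

theorem mainTheorem5: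
  fixes \<Lambda> \<Omega> :: "'a::wellorder set" and white black :: 'l
  assumes "finite \<Omega>" and "\<Omega> \<noteq> {}"
    and "infinite \<Lambda>" and "\<Omega> \<subseteq> \<Lambda>"
    and "\<forall>\<alpha>\<in>\<Omega>. \<forall>\<beta>\<in>\<Lambda> - \<Omega>. \<alpha> < \<beta>"
    and "white \<noteq> black"
  shows "(\<forall>A\<in>Pow (Pow \<Omega>). \<exists>!X. is_phi_value \<Lambda> \<Omega> white black A X) \<and>
    phi \<Lambda> \<Omega> white black \<in> Pow (Pow \<Omega>) \<rightarrow> extended_graphs \<Lambda> \<Omega> \<and>
    inj_on (phi \<Lambda> \<Omega> white black) (Pow (Pow \<Omega>)) \<and>
    Sym_invariant \<Omega> (set_act (set_act point_act)) (ext_act \<Omega>) (Pow (Pow \<Omega>))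
      (phi \<Lambda> \<Omega> white black) \<and>
    (\<forall>A\<in>Pow (Pow \<Omega>). \<forall>B\<in>Pow (Pow \<Omega>).
      perfect_refiner \<Omega> (ext_act \<Omega>) (extended_graphs \<Lambda> \<Omega>)
        (Transp \<Omega> (set_act (set_act point_act)) A B)
        (\<lambda>_. [phi \<Lambda> \<Omega> white black A], \<lambda>_. [phi \<Lambda> \<Omega> white black B]))"
proof -
  have inf: "infinite (\<Lambda> - \<Omega>)" using assms(1,3) by simp
  note fin = assms(1)
  have inj: "inj_on (phi \<Lambda> \<Omega> white black) (Pow (Pow \<Omega>))"
    and inv: "Sym_invariant \<Omega> (set_act (set_act point_act)) (ext_act \<Omega>) (Pow (Pow \<Omega>))
      (phi \<Lambda> \<Omega> white black)"
    by (rule inj_on_phi[OF inf fin], rule Sym_invariant_phi[OF inf fin])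
  have range: "phi \<Lambda> \<Omega> white black A \<in> extended_graphs \<Lambda> \<Omega>" if A: "A \<in> Pow (Pow \<Omega>)" for A
  proof -
    obtain As where "set As = A" "distinct As"
      "phi \<Lambda> \<Omega> white black A = ext_orbit \<Omega> (Gamma \<Lambda> \<Omega> white black As)"
      by (rule phi_indexing[OF inf fin PowD[OF A]])
    then show ?thesis
      using ext_orbit_Gamma_in_extended_graphs[OF inf fin assms(4), of As white black] A by simp
  qed
  have "perfect_refiner \<Omega> (ext_act \<Omega>) (extended_graphs \<Lambda> \<Omega>)
      (Transp \<Omega> (set_act (set_act point_act)) A B)
      (\<lambda>_. [phi \<Lambda> \<Omega> white black A], \<lambda>_. [phi \<Lambda> \<Omega> white black B])"
    if AB: "A \<in> Pow (Pow \<Omega>)" "B \<in> Pow (Pow \<Omega>)" for A B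
  proof -
    \<comment> \<open>Invariance turns the left side into an equation between two values of
      \<open>phi\<close>, which injectivity cancels because the image of A under \<open>g\<close> is
      again in \<open>Pow (Pow \<Omega>)\<close>.\<close>
    have "ext_act \<Omega> (phi \<Lambda> \<Omega> white black A) g = phi \<Lambda> \<Omega> white black B \<longleftrightarrow>
        set_act (set_act point_act) A g = B" if "g \<in> Sym \<Omega>" for g
      using inv AB that inj_on_eq_iff[OF inj set_act_in_Pow_Pow[OF AB(1) that] AB(2)]
      unfolding Sym_invariant_def by auto
    then have "Transp \<Omega> (set_act (set_act point_act)) A B =
        Transp \<Omega> (ext_act \<Omega>) (phi \<Lambda> \<Omega> white black A) (phi \<Lambda> \<Omega> white black B)"
      unfolding Transp_def by blast
    then show ?thesis using perfect_refiner_constI[OF range range] AB by simp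
  qed
  then show ?thesis using inj inv range by (intro conjI ballI Pi_I ex1_is_phi_value[OF inf fin PowD])
qed

end
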